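(* Let $0\le\mu<L$, let $f\in\mathcal{F}_{\mu,L}$ attain its minimum value $f_*$, let $x_0\in\mathbb{R}^n$ and $N\in\mathbb{N}$. Consider the iteration $$x_{k+1}=x_k-\gamma_k\nabla f(x_k),\qquad \gamma_k=\frac1L\left(2-\frac{\|\nabla f(x_k)\|^2}{2L(f(x_k)-f_* )}\right),\qquad k\ge0.$$ If the step sizes $\gamma_0,\dots,\gamma_{N-1}$ are well defined (i.e. no denominator vanishes), then $$f(x_N)-f_*\le\left(\prod_{k=0}^{N-1}\rho(\gamma_k)\right)(f(x_0)-f_* ),\qquad\text{where } \rho(\gamma)=(L\gamma-1)\bigl(L\gamma(3-\gamma(L+\mu))-1\bigr),$$ and $$\max_{\gamma\in[\frac1L,\frac{2L-\mu}{L^2}]}\rho(\gamma)=\frac{(L-\mu)^2}{(L+\mu)^2}.$$ Otherwise (if the step sizes are not all well defined), $\nabla f(x_k)=0$ for some $k\in\{0,\dots,N\}$.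
   Context: $\|\cdot\|$ is the Euclidean norm on $\mathbb{R}^n$. $\mathcal{F}_{\mu,L}$ denotes the class of differentiable functions $f:\mathbb{R}^n\to\mathbb{R}$ that are $L$-smooth and $\mu$-strongly convex, i.e. for all $x,y\in\mathbb{R}^n$: $f(y)\le f(x)+\langle\nabla f(x),y-x\rangle+\frac L2\|y-x\|^2$ and $f(y)\ge f(x)+\langle\nabla f(x),y-x\rangle+\frac\mu2\|y-x\|^2$ (for $\mu=0$ this means convex and $L$-smooth). *)

theory Defs
  imports "HOL-Analysis.Analysis"
begin

definition grad :: "(real ^ 'n \<Rightarrow> real) \<Rightarrow> real ^ 'n \<Rightarrow> real ^ 'n"
  where "grad f x = (THE D. GDERIV f x :> D)"

definition smooth_strongly_convex :: "real \<Rightarrow> real \<Rightarrow> (real ^ 'n \<Rightarrow> real) set"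
  where "smooth_strongly_convex \<mu> L =
    {f. (\<forall>x. f differentiable (at x)) \<and>
        (\<forall>x y. f y \<le> f x + grad f x \<bullet> (y - x) + L / 2 * (norm (y - x))\<^sup>2) \<and>
        (\<forall>x y. f y \<ge> f x + grad f x \<bullet> (y - x) + \<mu> / 2 * (norm (y - x))\<^sup>2)}"

definition step_size :: "real \<Rightarrow> real \<Rightarrow> (real ^ 'n \<Rightarrow> real) \<Rightarrow> real ^ 'n \<Rightarrow> real"
  where "step_size L fstar f x =
    1 / L * (2 - (norm (grad f x))\<^sup>2 / (2 * L * (f x - fstar)))"

definition step_defined :: "real \<Rightarrow> real \<Rightarrow> (real ^ 'n \<Rightarrow> real) \<Rightarrow> real ^ 'n \<Rightarrow> bool"
  where "step_defined L fstar f x \<longleftrightarrow> 2 * L * (f x - fstar) \<noteq> 0"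

text \<open>The recursion is imposed only as long as all step sizes so far are well defined. After the
  first index with a vanishing denominator the sequence is arbitrary, so the convention
  \<open>a / 0 = 0\<close> never produces an iterate.\<close>

definition gd_iterates ::
    "real \<Rightarrow> real \<Rightarrow> (real ^ 'n \<Rightarrow> real) \<Rightarrow> real ^ 'n \<Rightarrow> (nat \<Rightarrow> real ^ 'n) \<Rightarrow> bool"
  where "gd_iterates L fstar f x0 x \<longleftrightarrow>
    x 0 = x0 \<and>
    (\<forall>k. (\<forall>j\<le>k. step_defined L fstar f (x j)) \<longrightarrow>
         x (Suc k) = x k - step_size L fstar f (x k) *\<^sub>R grad f (x k))"

definition rate :: "real \<Rightarrow> real \<Rightarrow> real \<Rightarrow> real"
  where "rate \<mu> L \<gamma> = (L * \<gamma> - 1) * (L * \<gamma> * (3 - \<gamma> * (L + \<mu>)) - 1)"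

end

theory Submission
  imports Defs
begin

text \<open>Testing the upper bound at one point and the lower bound at another against a common third
  point, and optimising over it, gives the interpolation inequality of the class. With \<open>y\<close> the next
  iterate and \<open>z\<close> a minimiser, weight the inequalities for the pairs \<open>(x, y)\<close>, \<open>(z, x)\<close>, \<open>(z, y)\<close>
  by \<open>1 - \<mu>\<gamma>\<close>, \<open>\<mu>\<gamma>(L\<gamma> - 1)\<close>, \<open>\<mu>\<gamma>\<close>. Up to one perfect square, all terms cancel except
  a multiple of \<open>\<parallel>\<nabla>f x\<parallel>\<^sup>2\<close>, and this norm is \<open>2L(2 - L\<gamma>)(f x - f\<^sub>*)\<close> by the choice of \<open>\<gamma>\<close>.
  So one step contracts the gap by \<open>rate \<mu> L \<gamma>\<close>. That the product bound can be iterated needs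
  \<open>rate \<mu> L \<gamma> \<ge> 0\<close>, which holds because the new gap is nonnegative and the old one is positive.\<close>

lemma smooth_strongly_convexD:
  assumes "f \<in> smooth_strongly_convex \<mu> L"
  shows "f y \<le> f x + grad f x \<bullet> (y - x) + L / 2 * (norm (y - x))\<^sup>2"
    and "f y \<ge> f x + grad f x \<bullet> (y - x) + \<mu> / 2 * (norm (y - x))\<^sup>2"
  using assms unfolding smooth_strongly_convex_def by auto

text \<open>This is cocoercivity of the gradient of \<open>f\<close> minus \<open>\<mu> / 2\<close>
  times the squared norm, multiplied by \<open>2 * (L - \<mu>)\<close> to clear
  denominators.\<close>

lemma interpolation_inequality:
  assumes f: "f \<in> smooth_strongly_convex \<mu> L" and "\<mu> < L"
  shows "(L - \<mu>) * \<mu> * (norm (x - y))\<^sup>2 + (norm (grad f y - grad f x + \<mu> *\<^sub>R (x - y)))\<^sup>2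
    \<le> 2 * (L - \<mu>) * (f x - f y - grad f y \<bullet> (x - y))"
proof -
  define d where "d = x - y"
  define h where "h = grad f y - grad f x + \<mu> *\<^sub>R d"
  \<comment> \<open>The third point is \<open>x + w\<close>. This \<open>w\<close> maximises the
    lower bound based at \<open>y\<close> minus the upper bound based at \<open>x\<close>: the
    gradient of that difference in \<open>w\<close> is
    \<open>h - (L - \<mu>) *\<^sub>R w\<close>.\<close>
  define w where "w = (1 / (L - \<mu>)) *\<^sub>R h"
  have h: "h = (L - \<mu>) *\<^sub>R w"
    using \<open>\<mu> < L\<close> by (simp add: w_def)
  have gx: "grad f x = grad f y + \<mu> *\<^sub>R d - (L - \<mu>) *\<^sub>R w"
    using h by (simp add: h_def algebra_simps)
  have "f y + grad f y \<bullet> (d + w) + \<mu> / 2 * (norm (d + w))\<^sup>2 \<le> f (x + w)"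
    using smooth_strongly_convexD(2)[OF f, of y "x + w"] by (simp add: d_def algebra_simps)
  also have "\<dots> \<le> f x + grad f x \<bullet> w + L / 2 * (norm w)\<^sup>2"
    using smooth_strongly_convexD(1)[OF f, of "x + w" x] by simp
  finally have "\<mu> * (d \<bullet> d) + (L - \<mu>) * (w \<bullet> w) \<le> 2 * (f x - f y - grad f y \<bullet> d)"
    unfolding gx power2_norm_eq_inner
    by (simp add: inner_simps inner_commute[of w d] field_simps)
  then have "(L - \<mu>) * (\<mu> * (d \<bullet> d) + (L - \<mu>) * (w \<bullet> w))
      \<le> (L - \<mu>) * (2 * (f x - f y - grad f y \<bullet> d))"
    using \<open>\<mu> < L\<close> by (intro mult_left_mono) auto
  moreover have "(norm h)\<^sup>2 = (L - \<mu>) * ((L - \<mu>) * (w \<bullet> w))"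
    unfolding h power2_norm_eq_inner by simp
  ultimately show ?thesis
    unfolding d_def[symmetric] h_def[symmetric] power2_norm_eq_inner[of d]
    by (simp add: algebra_simps)
qed

text \<open>The quadratic upper bound at \<open>x\<close> is smallest after a gradient step of
  length \<open>1 / L\<close>, and its value there still dominates \<open>fstar\<close>.\<close>

lemma grad_norm_le_gap:
  assumes f: "f \<in> smooth_strongly_convex \<mu> L" and "0 < L" and min: "\<forall>y. fstar \<le> f y"
  shows "(norm (grad f x))\<^sup>2 \<le> 2 * L * (f x - fstar)"
proof -
  have "fstar \<le> f (x - (1 / L) *\<^sub>R grad f x)"
    using min by blast
  also have "\<dots> \<le> f x - (norm (grad f x))\<^sup>2 / (2 * L)"
    using smooth_strongly_convexD(1)[OF f, of "x - (1 / L) *\<^sub>R grad f x" x] \<open>0 < L\<close>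
    by (simp add: dot_square_norm power_divide power2_eq_square[of L])
  finally show ?thesis
    using \<open>0 < L\<close> by (simp add: field_simps)
qed

text \<open>This is the Polyak-Lojasiewicz inequality. Completing the square instead of minimising
  the lower bound avoids a division by \<mu>, so \<open>\<mu> = 0\<close> is no special
  case.\<close>

lemma gap_le_grad_norm:
  assumes f: "f \<in> smooth_strongly_convex \<mu> L" and "0 \<le> \<mu>" and "f z = fstar"
  shows "2 * \<mu> * (f x - fstar) \<le> (norm (grad f x))\<^sup>2"
proof -
  have "0 \<le> (norm (grad f x + \<mu> *\<^sub>R (z - x)))\<^sup>2"
    by simp
  also have "\<dots> = (norm (grad f x))\<^sup>2
      + 2 * \<mu> * (grad f x \<bullet> (z - x) + \<mu> / 2 * (norm (z - x))\<^sup>2)"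
    unfolding power2_norm_eq_inner inner_add_left inner_add_right inner_scaleR_left
      inner_scaleR_right inner_commute[of "z - x" "grad f x"]
    by algebra
  also have "\<dots> \<le> (norm (grad f x))\<^sup>2 + 2 * \<mu> * (fstar - f x)"
    using smooth_strongly_convexD(2)[OF f, of x z] assms(2,3)
    by (intro add_left_mono mult_left_mono) auto
  finally show ?thesis
    by (simp add: algebra_simps)
qed

text \<open>The unsimplified products are kept so that the identity matches, as a rewrite rule, the
  expanded squares in the next proof.\<close>

lemma weighted_interpolation_identity:
  fixes L \<mu> \<gamma> uu uv uw vv vw ww fx fy fz :: real
  shows "(1 - \<mu> * \<gamma>) * (2 * (L - \<mu>) * (fx - fy - \<gamma> * vw) - (L - \<mu>) * \<mu> * (\<gamma>\<^sup>2 * vv)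
        - ((\<mu> * \<gamma> - 1)\<^sup>2 * vv + ww + 2 * (\<mu> * \<gamma> - 1) * vw))
      + \<mu> * \<gamma> * (L * \<gamma> - 1) * (2 * (L - \<mu>) * (fz - fx - - uv) - (L - \<mu>) * \<mu> * uu
        - (\<mu>\<^sup>2 * uu + vv + 2 * - \<mu> * uv))
      + (\<mu> * \<gamma> * (2 * (L - \<mu>) * (fz - fy - (\<gamma> * vw - uw))
          - (L - \<mu>) * \<mu> * (uu + \<gamma>\<^sup>2 * vv + 2 * - 1 * \<gamma> * uv)
          - (\<mu>\<^sup>2 * uu + (\<mu> * \<gamma>)\<^sup>2 * vv + ww + 2 * - \<mu> * (\<mu> * \<gamma>) * uv
            + 2 * - \<mu> * uw + 2 * (\<mu> * \<gamma>) * vw))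
        + ((\<mu> * L * \<gamma>)\<^sup>2 * uu + (1 - \<mu> * \<gamma> - L * \<gamma>)\<^sup>2 * vv + ww
          + 2 * - (\<mu> * L * \<gamma>) * - (1 - \<mu> * \<gamma> - L * \<gamma>) * uv
          + 2 * - (\<mu> * L * \<gamma>) * uw + 2 * - (1 - \<mu> * \<gamma> - L * \<gamma>) * vw))
    = (L - \<mu>) * (2 * (1 - \<mu> * \<gamma> - \<mu> * \<gamma> * (L * \<gamma> - 1)) * (fx - fz)
        + \<gamma> * (\<gamma> * (L + \<mu>) - 2) * vv - 2 * (fy - fz))"
  by (simp add: power2_eq_square algebra_simps)

text \<open>The two conditions on \<gamma> make the three weights nonnegative. The Polyak choice of
  \<gamma> enters only later, through the remaining gradient norm.\<close>

lemma gradient_step_gap: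
  fixes f :: "real ^ 'n \<Rightarrow> real"
  assumes f: "f \<in> smooth_strongly_convex \<mu> L" and "0 \<le> \<mu>" "\<mu> < L"
    and z: "f z = fstar" "grad f z = 0"
    and \<gamma>: "1 \<le> L * \<gamma>" "\<mu> * \<gamma> \<le> 1"
  shows "2 * (f (x - \<gamma> *\<^sub>R grad f x) - fstar)
    \<le> 2 * (1 - \<mu> * \<gamma> - \<mu> * \<gamma> * (L * \<gamma> - 1)) * (f x - fstar)
      + \<gamma> * (\<gamma> * (L + \<mu>) - 2) * (norm (grad f x))\<^sup>2"
proof -
  define y where "y = x - \<gamma> *\<^sub>R grad f x"
  define u where "u = x - z"
  define v where "v = grad f x"
  define w where "w = grad f y"
  have "0 \<le> \<gamma>"
    using \<gamma>(1) \<open>0 \<le> \<mu>\<close> \<open>\<mu> < L\<close>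
    by (smt (verit) mult_nonneg_nonpos)
  have xy: "x - y = \<gamma> *\<^sub>R v" and zx: "z - x = - u" and zy: "z - y = \<gamma> *\<^sub>R v - u"
    by (simp_all add: y_def u_def v_def)
  have expand: "v \<bullet> (- u) = - (u \<bullet> v)"
    "w \<bullet> (\<gamma> *\<^sub>R v) = \<gamma> * (v \<bullet> w)"
    "w \<bullet> (\<gamma> *\<^sub>R v - u) = \<gamma> * (v \<bullet> w) - u \<bullet> w"
    by (simp_all add: inner_diff_right inner_commute)
  have norm_sum: "(norm (a *\<^sub>R u + b *\<^sub>R v + c *\<^sub>R w))\<^sup>2
      = a\<^sup>2 * (u \<bullet> u) + b\<^sup>2 * (v \<bullet> v) + c\<^sup>2 * (w \<bullet> w)
        + 2 * a * b * (u \<bullet> v) + 2 * a * c * (u \<bullet> w) + 2 * b * c * (v \<bullet> w)" for a b c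
    unfolding power2_norm_eq_inner
    by (simp add: inner_add_left inner_add_right inner_commute[of v u] inner_commute[of w u]
        inner_commute[of w v] power2_eq_square distrib_left)
  \<comment> \<open>Explicit coefficients, zeros included, let the single expansion
    \<open>norm_sum\<close> serve every norm below.\<close>
  have norms:
    "\<gamma> *\<^sub>R v = 0 *\<^sub>R u + \<gamma> *\<^sub>R v + 0 *\<^sub>R w"
    "w - v + \<mu> *\<^sub>R (\<gamma> *\<^sub>R v) = 0 *\<^sub>R u + (\<mu> * \<gamma> - 1) *\<^sub>R v + 1 *\<^sub>R w"
    "- u = (- 1) *\<^sub>R u + 0 *\<^sub>R v + 0 *\<^sub>R w"
    "v + \<mu> *\<^sub>R (- u) = (- \<mu>) *\<^sub>R u + 1 *\<^sub>R v + 0 *\<^sub>R w"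
    "\<gamma> *\<^sub>R v - u = (- 1) *\<^sub>R u + \<gamma> *\<^sub>R v + 0 *\<^sub>R w"
    "w + \<mu> *\<^sub>R (\<gamma> *\<^sub>R v - u) = (- \<mu>) *\<^sub>R u + (\<mu> * \<gamma>) *\<^sub>R v + 1 *\<^sub>R w"
    "w - (\<mu> * L * \<gamma>) *\<^sub>R u - (1 - \<mu> * \<gamma> - L * \<gamma>) *\<^sub>R v
      = (- (\<mu> * L * \<gamma>)) *\<^sub>R u + (- (1 - \<mu> * \<gamma> - L * \<gamma>)) *\<^sub>R v + 1 *\<^sub>R w"
    by (simp_all add: algebra_simps)
  note norm_expand = norms[THEN arg_cong, of "\<lambda>t. (norm t)\<^sup>2",
    unfolded norm_sum mult_zero_left mult_zero_right zero_power2 mult_1_left mult_1_right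
      power_one power2_minus add_0_left add_0_right]
  have I1: "0 \<le> (1 - \<mu> * \<gamma>) * (2 * (L - \<mu>) * (f x - f y - w \<bullet> (\<gamma> *\<^sub>R v))
      - (L - \<mu>) * \<mu> * (norm (\<gamma> *\<^sub>R v))\<^sup>2 - (norm (w - v + \<mu> *\<^sub>R (\<gamma> *\<^sub>R v)))\<^sup>2)"
    using interpolation_inequality[OF f \<open>\<mu> < L\<close>, of x y] \<gamma>
    unfolding xy v_def[symmetric] w_def[symmetric]
    by (intro mult_nonneg_nonneg) auto
  have I2: "0 \<le> (\<mu> * \<gamma> * (L * \<gamma> - 1)) * (2 * (L - \<mu>) * (fstar - f x - v \<bullet> (- u))
      - (L - \<mu>) * \<mu> * (norm (- u))\<^sup>2 - (norm (v + \<mu> *\<^sub>R (- u)))\<^sup>2)"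
    using interpolation_inequality[OF f \<open>\<mu> < L\<close>, of z x] \<gamma> \<open>0 \<le> \<gamma>\<close> \<open>0 \<le> \<mu>\<close>
    unfolding zx z v_def[symmetric]
    by (intro mult_nonneg_nonneg) auto
  have I3: "0 \<le> (\<mu> * \<gamma>) * (2 * (L - \<mu>) * (fstar - f y - w \<bullet> (\<gamma> *\<^sub>R v - u))
      - (L - \<mu>) * \<mu> * (norm (\<gamma> *\<^sub>R v - u))\<^sup>2 - (norm (w + \<mu> *\<^sub>R (\<gamma> *\<^sub>R v - u)))\<^sup>2)"
    using interpolation_inequality[OF f \<open>\<mu> < L\<close>, of z y] \<gamma> \<open>0 \<le> \<gamma>\<close> \<open>0 \<le> \<mu>\<close>
    unfolding zy z w_def[symmetric]
    by (intro mult_nonneg_nonneg) auto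
  \<comment> \<open>The weights \<open>1 - \<mu> * \<gamma>\<close> and
    \<open>\<mu> * \<gamma>\<close> add up to 1, so \<open>w \<bullet> w\<close> cancels against
    this square; its coefficients of \<open>u\<close> and \<open>v\<close> are those that also
    cancel \<open>u \<bullet> w\<close> and \<open>v \<bullet> w\<close>.\<close>
  have sq: "0 \<le> (norm (w - (\<mu> * L * \<gamma>) *\<^sub>R u - (1 - \<mu> * \<gamma> - L * \<gamma>) *\<^sub>R v))\<^sup>2"
    by simp
  have "0 \<le> (L - \<mu>) * (2 * (1 - \<mu> * \<gamma> - \<mu> * \<gamma> * (L * \<gamma> - 1)) * (f x - fstar)
      + \<gamma> * (\<gamma> * (L + \<mu>) - 2) * (norm v)\<^sup>2 - 2 * (f y - fstar))"
    using add_nonneg_nonneg[OF add_nonneg_nonneg[OF I1 I2] add_nonneg_nonneg[OF I3 sq]]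
    unfolding expand norm_expand power2_norm_eq_inner[of v]
    by (simp only: weighted_interpolation_identity)
  then show ?thesis
    using \<open>\<mu> < L\<close> by (simp add: zero_le_mult_iff y_def v_def)
qed

text \<open>Read through the step size formula, the two bounds on the gradient norm say that
  \<gamma> lies between \<open>1 / L\<close> and \<open>(2 * L - \<mu>) / L\<^sup>2\<close>. This
  yields the conditions on \<gamma> in \<open>gradient_step_gap\<close>.\<close>

lemma polyak_step_gap:
  fixes f :: "real ^ 'n \<Rightarrow> real"
  assumes f: "f \<in> smooth_strongly_convex \<mu> L" and "0 \<le> \<mu>" "\<mu> < L"
    and z: "f z = fstar" and min: "\<forall>y. fstar \<le> f y"
    and "step_defined L fstar f x"
  shows "f (x - step_size L fstar f x *\<^sub>R grad f x) - fstar
    \<le> rate \<mu> L (step_size L fstar f x) * (f x - fstar)"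
proof -
  define \<gamma> where "\<gamma> = step_size L fstar f x"
  define \<delta> where "\<delta> = f x - fstar"
  have "0 < L"
    using assms by simp
  have "0 < \<delta>"
    using \<open>step_defined L fstar f x\<close> min[rule_format, of x] by (auto simp: step_defined_def \<delta>_def)
  have "L * \<gamma> = 2 - (norm (grad f x))\<^sup>2 / (2 * L * \<delta>)"
    using \<open>0 < L\<close> by (simp add: \<gamma>_def \<delta>_def step_size_def)
  then have norm_eq: "(norm (grad f x))\<^sup>2 = 2 * L * \<delta> * (2 - L * \<gamma>)"
    using \<open>0 < L\<close> \<open>0 < \<delta>\<close> by (simp add: field_simps)
  have "2 * L * \<delta> * (2 - L * \<gamma>) \<le> 2 * L * \<delta> * 1"
    using grad_norm_le_gap[OF f \<open>0 < L\<close> min, of x] by (simp add: norm_eq \<delta>_def)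
  then have \<gamma>1: "1 \<le> L * \<gamma>"
    using \<open>0 < L\<close> \<open>0 < \<delta>\<close> by (subst (asm) mult_le_cancel_left_pos) auto
  have "2 * \<delta> * \<mu> \<le> 2 * \<delta> * (L * (2 - L * \<gamma>))"
    using gap_le_grad_norm[OF f \<open>0 \<le> \<mu>\<close> z, of x] by (simp add: norm_eq \<delta>_def mult_ac)
  then have "\<mu> \<le> L * (2 - L * \<gamma>)"
    using \<open>0 < \<delta>\<close> by (subst (asm) mult_le_cancel_left_pos) auto
  \<comment> \<open>With this upper end for \<gamma>, the bound
    \<open>\<mu> * \<gamma> \<le> 1\<close> reduces to
    \<open>\<mu> * (2 * L - \<mu>) \<le> L * L\<close>, that is, to a square being
    nonnegative.\<close>
  then have "\<mu> * (L * (L * \<gamma>)) \<le> \<mu> * (2 * L - \<mu>)"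
    using \<open>0 \<le> \<mu>\<close> by (intro mult_left_mono) (auto simp: algebra_simps)
  also have "\<dots> \<le> L * L"
    using zero_le_square[of "L - \<mu>"] by (simp add: algebra_simps)
  finally have "(L * L) * (\<mu> * \<gamma>) \<le> (L * L) * 1"
    by (simp add: mult_ac)
  then have \<gamma>2: "\<mu> * \<gamma> \<le> 1"
    using \<open>0 < L\<close> by (subst (asm) mult_le_cancel_left_pos) auto
  \<comment> \<open>The gap at \<open>z\<close> is zero, so the gradient bound gives stationarity
    without a derivative test.\<close>
  have "(norm (grad f z))\<^sup>2 \<le> 0"
    using grad_norm_le_gap[OF f \<open>0 < L\<close> min, of z] z by simp
  then have "grad f z = 0"
    by simp
  from gradient_step_gap[OF f \<open>0 \<le> \<mu>\<close> \<open>\<mu> < L\<close> z this \<gamma>1 \<gamma>2, of x]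
  show ?thesis
    unfolding norm_eq \<delta>_def[symmetric] \<gamma>_def[symmetric] rate_def
    by (simp add: algebra_simps)
qed

text \<open>After clearing the denominator, the difference of the two sides factors with a double
  root at \<open>2 / (L + \<mu>)\<close>; the remaining linear factor is nonnegative because
  \<open>1 \<le> L * \<gamma>\<close>.\<close>

lemma rate_upper_bound:
  assumes "0 \<le> \<mu>" "\<mu> < L" "1 / L \<le> \<gamma>"
  shows "rate \<mu> L \<gamma> \<le> (L - \<mu>)\<^sup>2 / (L + \<mu>)\<^sup>2"
proof -
  have L: "0 < L" "1 \<le> L * \<gamma>"
    using assms by (auto simp: field_simps)
  have "\<mu> \<le> (L + \<mu>) * 1"
    using L by simp
  also have "\<dots> \<le> (L + \<mu>) * (L * \<gamma>)"
    using L assms by (intro mult_left_mono) auto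
  finally have "0 \<le> L * ((L + \<mu>) * \<gamma> - 2)\<^sup>2 * ((L + \<mu>) * (L * \<gamma>) - \<mu>)"
    using L by simp
  also have "\<dots> = (L - \<mu>)\<^sup>2 - rate \<mu> L \<gamma> * (L + \<mu>)\<^sup>2"
    unfolding rate_def by algebra
  finally have "rate \<mu> L \<gamma> * (L + \<mu>)\<^sup>2 \<le> (L - \<mu>)\<^sup>2"
    by simp
  then show ?thesis
    using L assms by (simp add: pos_le_divide_eq)
qed

lemma rate_at_maximizer:
  assumes "0 < L + \<mu>"
  shows "rate \<mu> L (2 / (L + \<mu>)) = (L - \<mu>)\<^sup>2 / (L + \<mu>)\<^sup>2"
proof -
  have "L * (2 / (L + \<mu>)) - 1 = (L - \<mu>) / (L + \<mu>)"
    using assms by (simp add: field_simps)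
  moreover have "3 - 2 / (L + \<mu>) * (L + \<mu>) = 1"
    using assms by (simp add: field_simps)
  ultimately show ?thesis
    unfolding rate_def by (simp only: mult_1_right power2_eq_square times_divide_times_eq)
qed

lemma rate_maximizer_in_interval:
  fixes \<mu> L :: real
  assumes "0 \<le> \<mu>" "\<mu> < L"
  shows "2 / (L + \<mu>) \<in> {1 / L .. (2 * L - \<mu>) / L\<^sup>2}"
proof -
  \<comment> \<open>This product is \<open>(2 * L - \<mu>) * (L + \<mu>) - 2 * L\<^sup>2\<close>,
    whose sign decides the upper end of the interval.\<close>
  have "0 \<le> \<mu> * (L - \<mu>)"
    using assms by simp
  then show ?thesis
    using assms by (simp add: divide_simps power2_eq_square algebra_simps)
qed

theorem proposition2:
  fixes f :: "real ^ 'n \<Rightarrow> real" and \<mu> L fstar :: real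
    and x0 :: "real ^ 'n" and x :: "nat \<Rightarrow> real ^ 'n" and N :: nat
  assumes "0 \<le> \<mu>" and "\<mu> < L"
    and "f \<in> smooth_strongly_convex \<mu> L"
    and "\<exists>z. f z = fstar" and "\<forall>y. fstar \<le> f y"
    and "gd_iterates L fstar f x0 x"
  shows "((\<forall>k<N. step_defined L fstar f (x k)) \<longrightarrow>
            f (x N) - fstar \<le> (\<Prod>k<N. rate \<mu> L (step_size L fstar f (x k))) * (f x0 - fstar)) \<and>
         ((L - \<mu>)\<^sup>2 / (L + \<mu>)\<^sup>2 \<in> rate \<mu> L ` {1 / L .. (2 * L - \<mu>) / L\<^sup>2} \<and>
            (\<forall>\<gamma>\<in>{1 / L .. (2 * L - \<mu>) / L\<^sup>2}. rate \<mu> L \<gamma> \<le> (L - \<mu>)\<^sup>2 / (L + \<mu>)\<^sup>2)) \<and>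
         (\<not> (\<forall>k<N. step_defined L fstar f (x k)) \<longrightarrow>
            (\<exists>k\<le>N. (\<forall>j<k. step_defined L fstar f (x j)) \<and> grad f (x k) = 0))"
proof (intro conjI impI)
  obtain z where z: "f z = fstar"
    using assms(4) by blast
  show "f (x N) - fstar \<le> (\<Prod>k<N. rate \<mu> L (step_size L fstar f (x k))) * (f x0 - fstar)"
    if "\<forall>k<N. step_defined L fstar f (x k)"
    using that
  proof (induction N)
    case 0
    then show ?case
      using assms(6) by (simp add: gd_iterates_def)
  next
    case (Suc N)
    let ?r = "rate \<mu> L (step_size L fstar f (x N))"
    have "x (Suc N) = x N - step_size L fstar f (x N) *\<^sub>R grad f (x N)"
      using assms(6) Suc.prems by (simp add: gd_iterates_def)
    then have step: "f (x (Suc N)) - fstar \<le> ?r * (f (x N) - fstar)"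
      using polyak_step_gap[OF assms(3,1,2) z assms(5), of "x N"] Suc.prems by simp
    have "0 < f (x N) - fstar"
      using Suc.prems assms(5)[rule_format, of "x N"]
      by (auto simp: step_defined_def less_le)
    moreover have "0 \<le> ?r * (f (x N) - fstar)"
      using step assms(5)[rule_format, of "x (Suc N)"] by linarith
    ultimately have "0 \<le> ?r"
      by (simp add: zero_le_mult_iff)
    then have "?r * (f (x N) - fstar)
        \<le> ?r * ((\<Prod>k<N. rate \<mu> L (step_size L fstar f (x k))) * (f x0 - fstar))"
      using Suc by (intro mult_left_mono) auto
    with step show ?case
      by (simp add: mult_ac)
  qed
  show "(L - \<mu>)\<^sup>2 / (L + \<mu>)\<^sup>2 \<in> rate \<mu> L ` {1 / L .. (2 * L - \<mu>) / L\<^sup>2}"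
    using rate_maximizer_in_interval[OF assms(1,2)] rate_at_maximizer[of L \<mu>] assms(1,2)
    by (intro image_eqI[where x = "2 / (L + \<mu>)"]) auto
  show "\<forall>\<gamma>\<in>{1 / L .. (2 * L - \<mu>) / L\<^sup>2}. rate \<mu> L \<gamma> \<le> (L - \<mu>)\<^sup>2 / (L + \<mu>)\<^sup>2"
    using rate_upper_bound[OF assms(1,2)] by simp
  show "\<exists>k\<le>N. (\<forall>j<k. step_defined L fstar f (x j)) \<and> grad f (x k) = 0"
    if "\<not> (\<forall>k<N. step_defined L fstar f (x k))"
  proof -
    from that obtain m where "m < N" "\<not> step_defined L fstar f (x m)"
      by blast
    \<comment> \<open>Taking the first undefined index ensures that \<open>x k\<close> is still
      produced by the recursion.\<close>
    then obtain k where k: "k \<le> m" "\<not> step_defined L fstar f (x k)"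
        "\<forall>j<k. step_defined L fstar f (x j)"
      using ex_least_nat_le[of "\<lambda>k. \<not> step_defined L fstar f (x k)" m] by blast
    \<comment> \<open>The right-hand side is the very quantity whose vanishing makes the step
      undefined.\<close>
    have "(norm (grad f (x k)))\<^sup>2 \<le> 2 * L * (f (x k) - fstar)"
      using grad_norm_le_gap[OF assms(3) _ assms(5)] assms(1,2) by simp
    then have "grad f (x k) = 0"
      using k(2) by (auto simp: step_defined_def)
    then show ?thesis
      using k \<open>m < N\<close> by (intro exI[of _ k]) auto
  qed
qed

end
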